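(* Let $w_c,w_d>0$ with $w_c+w_d=1$, and let $\mathbf C_s^{\,i}$, $\mathbf R_j$, $a_i,b_i,u_j,v_j,s_j$ be as in the context (functions of $p\in[0,1]$, and for $\mathbf C_s^{\,i},\mathbf R_j$ also of $\beta\in[0,1]$). For each fixed $p$, the optimal spectrum partition factor, i.e. a maximizer over $\beta\in[0,1]$ of $$\mathcal U=w_c\ln\left(\sum_{i=1}^n\mathbf C_s^{\,i}\right)+w_d\ln\left(\sum_{j=1}^m\mathbf R_j\right),$$ is given by $$\beta_1^*=\min\left\{\max\left\{0,\,-w_d\frac{\sum_{i=1}^nb_i}{\sum_{i=1}^na_i}-w_c\frac{\sum_{j=1}^m(v_j-s_j)}{\sum_{j=1}^m(u_j+s_j)}\right\},1\right\}$$ if $\sum_{j=1}^m(u_j+s_j)<0$, and by $\beta_1^*=1$ otherwise. In particular, $\lim_{p\to0}\beta_1^*=w_c$.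
   Context: Setting: a cellular network with a base station $B$, an eavesdropper $E$, $n\ge1$ cellular users $A_1,\dots,A_n$, and a set $\mathcal D=\{D_1,\dots,D_m\}$, $m\ge1$, of D2D pairs with transmitters $D_j^t$ and receivers $D_j^r$. The numbers $\gamma_{a,b}>0$ are the average signal-to-noise ratios from node $a$ to node $b$, with $\gamma_{A_i,D_j^r}\ne\gamma_{D_j^t,D_j^r}$ for all $i,j$. $p$ is the probability that a D2D pair is in underlay mode, $\beta$ the fraction of spectrum given to cellular users. Put $\varepsilon=\frac pn$, $\vartheta=p\left(1-\frac1n\right)$; $0^0=1$; $\ln 0=-\infty$. $2^{S}$ denotes the power set of $S$. $\Psi(x)=e^x\mathrm{Ei}(-x)=-e^x\int_x^\infty\frac{e^{-t}}t\,\mathrm dt$ for $x>0$. For nonempty $\mathbf D\subseteq\mathcal D$ let $\mathbf f_{\mathbf D}$, $\mathbf g_{\mathbf D}$ be the densities of a sum of independent exponential random variables, one for each $D_k\in\mathbf D$, with means $\gamma_{D_k^t,B}$, respectively $\gamma_{D_k^t,E}$; for nonempty $\mathbf D\subseteq\mathcal D\setminus\{D_j\}$ let $\mathbf h^j_{\mathbf D}$ be the density of such a sum with means $\gamma_{D_k^t,D_j^r}$. Define $$\Lambda_i(\emptyset)=\Psi\left(\tfrac1{\gamma_{A_i,B}}+\tfrac1{\gamma_{A_i,E}}\right)-\Psi\left(\tfrac1{\gamma_{A_i,B}}\right),$$ $$\Lambda_i(\mathbf D)=\int_0^\infty\!\!\int_0^\infty\left[\Psi\left(\tfrac{x+1}{\gamma_{A_i,B}}+\tfrac{y+1}{\gamma_{A_i,E}}\right)-\Psi\left(\tfrac{x+1}{\gamma_{A_i,B}}\right)\right]\mathbf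 f_{\mathbf D}(x)\mathbf g_{\mathbf D}(y)\,\mathrm dx\,\mathrm dy\quad(\mathbf D\ne\emptyset),$$ $$\Delta_{i,j}(\emptyset)=\Psi\left(\tfrac1{\gamma_{D_j^t,D_j^r}}\right)-\Psi\left(\tfrac1{\gamma_{A_i,D_j^r}}\right),$$ $$\Delta_{i,j}(\mathbf D)=\int_0^\infty\mathbf h^j_{\mathbf D}(x)\left[\Psi\left(\tfrac{x+1}{\gamma_{D_j^t,D_j^r}}\right)-\Psi\left(\tfrac{x+1}{\gamma_{A_i,D_j^r}}\right)\right]\mathrm dx\quad(\mathbf D\neq\emptyset).$$ Define $$a_i=\sum_{\mathbf D\in2^{\mathcal D}}\varepsilon^{|\mathbf D|}\Lambda_i(\mathbf D)\left((1-\varepsilon)^{m-|\mathbf D|}-\vartheta^{m-|\mathbf D|}\right),\qquad b_i=\sum_{\mathbf D\in2^{\mathcal D}}\varepsilon^{|\mathbf D|}\Lambda_i(\mathbf D)\vartheta^{m-|\mathbf D|},$$ $$u_j=\sum_{i=1}^n\sum_{\mathbf D\in2^{\mathcal D\setminus\{D_j\}}}\frac{\varepsilon^{|\mathbf D|+1}\Delta_{i,j}(\mathbf D)\left((1-\varepsilon)^{m-1-|\mathbf D|}-\vartheta^{m-1-|\mathbf D|}\right)}{n\left(\frac{\gamma_{A_i,D_j^r}}{\gamma_{D_j^t,D_j^r}}-1\right)},$$ $$v_j=\sum_{i=1}^n\sum_{\mathbf D\in2^{\mathcal D\setminus\{D_j\}}}\frac{\varepsilon^{|\mathbf D|+1}\Delta_{i,j}(\mathbf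 D)\,\vartheta^{m-1-|\mathbf D|}}{n\left(\frac{\gamma_{A_i,D_j^r}}{\gamma_{D_j^t,D_j^r}}-1\right)},\qquad s_j=\Psi\left(\tfrac1{\gamma_{D_j^t,D_j^r}}\right)\sum_{l=1}^m\binom{m-1}{l-1}\frac{p^{m-l}(1-p)^l}{l}.$$ The average secrecy capacity of $A_i$ and the average capacity of $D_j$ are $$\mathbf C_s^{\,i}=\frac{a_i\beta+b_i}{n\ln2},\qquad \mathbf R_j=\frac{(u_j+s_j)\beta+v_j-s_j}{\ln2}.$$ *)

theory Defs
  imports "HOL-Probability.Probability"
begin

text \<open>
  \<open>A i\<close> is a cellular user; \<open>DT j\<close> and \<open>DR j\<close> are the transmitter and the receiver of the
  D2D pair \<open>D\<^sub>j\<close>. A set of D2D pairs is represented by the set of their indices,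
  so the set of all pairs is \<open>{1..m}\<close>.
\<close>

datatype node = Base | Eve | A nat | DT nat | DR nat

definition nodes :: "nat \<Rightarrow> nat \<Rightarrow> node set" where
  "nodes n m = {Base, Eve} \<union> A ` {1..n} \<union> DT ` {1..m} \<union> DR ` {1..m}"

text \<open>\<open>e\<^sup>x Ei(-x)\<close>, used for \<open>x > 0\<close> only.\<close>

definition Psi :: "real \<Rightarrow> real" where
  "Psi x = - exp x * (LBINT t=ereal x..\<infinity>. exp (- t) / t)"

text \<open>
  The law of a sum of independent exponential random variables with means \<open>\<mu> k\<close> (i.e. rates
  \<open>1 / \<mu> k\<close>), \<open>k \<in> D\<close>, realised as the coordinates of a product space, and its density with
  respect to Lebesgue measure. The density is only determined almost everywhere; it is used
  only under integrals.
\<close>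

definition exp_sum_law :: "(nat \<Rightarrow> real) \<Rightarrow> nat set \<Rightarrow> real measure" where
  "exp_sum_law \<mu> D =
     distr (\<Pi>\<^sub>M k\<in>D. density lborel (\<lambda>x. ennreal (exponential_density (1 / \<mu> k) x)))
       borel (\<lambda>\<omega>. \<Sum>k\<in>D. \<omega> k)"

definition exp_sum_density :: "(nat \<Rightarrow> real) \<Rightarrow> nat set \<Rightarrow> real \<Rightarrow> real" where
  "exp_sum_density \<mu> D x = enn2real (RN_deriv lborel (exp_sum_law \<mu> D) x)"

definition f_dens :: "(node \<Rightarrow> node \<Rightarrow> real) \<Rightarrow> nat set \<Rightarrow> real \<Rightarrow> real" where
  "f_dens \<gamma> D = exp_sum_density (\<lambda>k. \<gamma> (DT k) Base) D"

definition g_dens :: "(node \<Rightarrow> node \<Rightarrow> real) \<Rightarrow> nat set \<Rightarrow> real \<Rightarrow> real" where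
  "g_dens \<gamma> D = exp_sum_density (\<lambda>k. \<gamma> (DT k) Eve) D"

definition h_dens :: "(node \<Rightarrow> node \<Rightarrow> real) \<Rightarrow> nat \<Rightarrow> nat set \<Rightarrow> real \<Rightarrow> real" where
  "h_dens \<gamma> j D = exp_sum_density (\<lambda>k. \<gamma> (DT k) (DR j)) D"

definition Lambda :: "(node \<Rightarrow> node \<Rightarrow> real) \<Rightarrow> nat \<Rightarrow> nat set \<Rightarrow> real" where
  "Lambda \<gamma> i D =
     (if D = {} then Psi (1 / \<gamma> (A i) Base + 1 / \<gamma> (A i) Eve) - Psi (1 / \<gamma> (A i) Base)
      else (LBINT y=0..\<infinity>. (LBINT x=0..\<infinity>.
        (Psi ((x + 1) / \<gamma> (A i) Base + (y + 1) / \<gamma> (A i) Eve) - Psi ((x + 1) / \<gamma> (A i) Base))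
          * f_dens \<gamma> D x * g_dens \<gamma> D y)))"

definition Delta :: "(node \<Rightarrow> node \<Rightarrow> real) \<Rightarrow> nat \<Rightarrow> nat \<Rightarrow> nat set \<Rightarrow> real" where
  "Delta \<gamma> i j D =
     (if D = {} then Psi (1 / \<gamma> (DT j) (DR j)) - Psi (1 / \<gamma> (A i) (DR j))
      else (LBINT x=0..\<infinity>. h_dens \<gamma> j D x
        * (Psi ((x + 1) / \<gamma> (DT j) (DR j)) - Psi ((x + 1) / \<gamma> (A i) (DR j)))))"

definition eps :: "nat \<Rightarrow> real \<Rightarrow> real" where
  "eps n p = p / real n"

definition vth :: "nat \<Rightarrow> real \<Rightarrow> real" where
  "vth n p = p * (1 - 1 / real n)"

definition coef_a :: "nat \<Rightarrow> nat \<Rightarrow> (node \<Rightarrow> node \<Rightarrow> real) \<Rightarrow> real \<Rightarrow> nat \<Rightarrow> real" where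
  "coef_a n m \<gamma> p i =
     (\<Sum>D\<in>Pow {1..m}. eps n p ^ card D * Lambda \<gamma> i D
        * ((1 - eps n p) ^ (m - card D) - vth n p ^ (m - card D)))"

definition coef_b :: "nat \<Rightarrow> nat \<Rightarrow> (node \<Rightarrow> node \<Rightarrow> real) \<Rightarrow> real \<Rightarrow> nat \<Rightarrow> real" where
  "coef_b n m \<gamma> p i =
     (\<Sum>D\<in>Pow {1..m}. eps n p ^ card D * Lambda \<gamma> i D * vth n p ^ (m - card D))"

definition coef_u :: "nat \<Rightarrow> nat \<Rightarrow> (node \<Rightarrow> node \<Rightarrow> real) \<Rightarrow> real \<Rightarrow> nat \<Rightarrow> real" where
  "coef_u n m \<gamma> p j =
     (\<Sum>i=1..n. \<Sum>D\<in>Pow ({1..m} - {j}).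
        eps n p ^ (card D + 1) * Delta \<gamma> i j D
          * ((1 - eps n p) ^ (m - 1 - card D) - vth n p ^ (m - 1 - card D))
        / (real n * (\<gamma> (A i) (DR j) / \<gamma> (DT j) (DR j) - 1)))"

definition coef_v :: "nat \<Rightarrow> nat \<Rightarrow> (node \<Rightarrow> node \<Rightarrow> real) \<Rightarrow> real \<Rightarrow> nat \<Rightarrow> real" where
  "coef_v n m \<gamma> p j =
     (\<Sum>i=1..n. \<Sum>D\<in>Pow ({1..m} - {j}).
        eps n p ^ (card D + 1) * Delta \<gamma> i j D * vth n p ^ (m - 1 - card D)
        / (real n * (\<gamma> (A i) (DR j) / \<gamma> (DT j) (DR j) - 1)))"

definition coef_s :: "nat \<Rightarrow> (node \<Rightarrow> node \<Rightarrow> real) \<Rightarrow> real \<Rightarrow> nat \<Rightarrow> real" where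
  "coef_s m \<gamma> p j =
     Psi (1 / \<gamma> (DT j) (DR j))
       * (\<Sum>l=1..m. real ((m - 1) choose (l - 1)) * (p ^ (m - l) * (1 - p) ^ l / real l))"

text \<open>Average secrecy capacity of \<open>A i\<close> and average capacity of \<open>D\<^sub>j\<close>.\<close>

definition Cs :: "nat \<Rightarrow> nat \<Rightarrow> (node \<Rightarrow> node \<Rightarrow> real) \<Rightarrow> real \<Rightarrow> real \<Rightarrow> nat \<Rightarrow> real" where
  "Cs n m \<gamma> p \<beta> i = (coef_a n m \<gamma> p i * \<beta> + coef_b n m \<gamma> p i) / (real n * ln 2)"

definition R :: "nat \<Rightarrow> nat \<Rightarrow> (node \<Rightarrow> node \<Rightarrow> real) \<Rightarrow> real \<Rightarrow> real \<Rightarrow> nat \<Rightarrow> real" where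
  "R n m \<gamma> p \<beta> j =
     ((coef_u n m \<gamma> p j + coef_s m \<gamma> p j) * \<beta> + coef_v n m \<gamma> p j - coef_s m \<gamma> p j) / ln 2"

text \<open>
  The logarithm with \<open>ln 0 = -\<infinity>\<close>, whereas the library has \<open>ln 0 = 0\<close> on the reals.
  Negative arguments, where the value is a dummy, do not arise: for \<open>p\<close> and \<open>\<beta>\<close> in \<open>[0,1]\<close>
  the capacities are nonnegative.
\<close>

definition eln :: "real \<Rightarrow> ereal" where
  "eln x = (if x > 0 then ereal (ln x) else - \<infinity>)"

definition utility ::
  "nat \<Rightarrow> nat \<Rightarrow> (node \<Rightarrow> node \<Rightarrow> real) \<Rightarrow> real \<Rightarrow> real \<Rightarrow> real \<Rightarrow> real \<Rightarrow> ereal" where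
  "utility n m \<gamma> w\<^sub>c w\<^sub>d p \<beta> =
     ereal w\<^sub>c * eln (\<Sum>i=1..n. Cs n m \<gamma> p \<beta> i) + ereal w\<^sub>d * eln (\<Sum>j=1..m. R n m \<gamma> p \<beta> j)"

definition beta_opt ::
  "nat \<Rightarrow> nat \<Rightarrow> (node \<Rightarrow> node \<Rightarrow> real) \<Rightarrow> real \<Rightarrow> real \<Rightarrow> real \<Rightarrow> real" where
  "beta_opt n m \<gamma> w\<^sub>c w\<^sub>d p =
     (if (\<Sum>j=1..m. coef_u n m \<gamma> p j + coef_s m \<gamma> p j) < 0
      then min (max 0
             (- w\<^sub>d * ((\<Sum>i=1..n. coef_b n m \<gamma> p i) / (\<Sum>i=1..n. coef_a n m \<gamma> p i))
              - w\<^sub>c * ((\<Sum>j=1..m. coef_v n m \<gamma> p j - coef_s m \<gamma> p j)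
                      / (\<Sum>j=1..m. coef_u n m \<gamma> p j + coef_s m \<gamma> p j)))) 1
      else 1)"

end

theory Submission
  imports Defs
begin

text \<open>
  Since \<open>Psi x = - \<integral>\<^bsub>0\<^esub>\<^bsup>\<infinity>\<^esup> exp (- s) / (x + s) ds\<close> is negative and strictly increasing, the
  coefficients have fixed signs. For given \<open>p\<close> both arguments of the logarithms are affine in
  \<open>\<beta>\<close>, and the first is nondecreasing; so either both are nondecreasing and \<open>\<beta> = 1\<close> is optimal,
  or the concave objective is maximal at its stationary point, clipped to \<open>[0,1]\<close>. At \<open>p = 0\<close> only the
  terms with \<open>D = {}\<close> in \<open>a\<close> and the term \<open>l = m\<close> in \<open>s\<close> survive.
\<close>

section \<open>Integral representation, sign and monotonicity of \<open>Psi\<close>\<close>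

lemma integrable_exp_shift:
  fixes x :: real
  assumes "x > 0"
  shows "integrable lborel (\<lambda>s. indicator {0<..} s * (exp (- s) / (x + s)))"
proof -
  have "integrable lborel (\<lambda>s. exp (- s) * indicator {0<..} s / x)"
    using has_bochner_integral_I0i_power_exp_m[of 0]
    by (intro integrable_divide_zero) (auto simp: integrable.simps)
  then show ?thesis
  proof (rule Bochner_Integration.integrable_bound)
    show "AE s in lborel. norm (indicator {0<..} s * (exp (- s) / (x + s)))
        \<le> norm (exp (- s) * indicator {0<..} s / x)"
      using assms by (intro AE_I2) (auto simp: indicator_def intro!: divide_left_mono)
  qed simp
qed

text \<open>The shift t = x + s produces a factor exp (- x), which cancels the factor in front. The
  domain no longer depends on x, so the integrals for different x can be compared pointwise.\<close>

lemma Psi_eq_integral: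
  "Psi x = - (LINT s|lborel. indicator {0<..} s * (exp (- s) / (x + s)))"
proof -
  have "(LBINT t=ereal x..\<infinity>. exp (- t) / t) = (LINT t|lborel. indicator {x<..} t * (exp (- t) / t))"
    by (simp add: interval_lebesgue_integral_def set_lebesgue_integral_def)
  also have "\<dots> = (LINT s|lborel. indicator {x<..} (x + s) * (exp (- (x + s)) / (x + s)))"
    using lborel_integral_real_affine[of 1 "\<lambda>t. indicator {x<..} t * (exp (- t) / t)" x] by simp
  also have "\<dots> = (LINT s|lborel. exp (- x) * (indicator {0<..} s * (exp (- s) / (x + s))))"
    by (intro Bochner_Integration.integral_cong)
      (auto simp: indicator_def exp_diff exp_minus field_simps)
  finally show ?thesis
    by (simp only: Psi_def integral_mult_right_zero) (simp flip: exp_add mult.assoc)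
qed

text \<open>A nonnegative function with integral 0 vanishes almost everywhere, whereas
  \<open>f\<close> has no zero in the unit interval. This supplies the strictness in both facts
  about \<open>Psi\<close>.\<close>

lemma integral_lborel_pos:
  fixes f :: "real \<Rightarrow> real"
  assumes "integrable lborel f" "\<And>x. 0 \<le> f x" "\<And>x. 0 < x \<Longrightarrow> 0 < f x"
  shows "0 < (LINT x|lborel. f x)"
proof -
  have "\<not> (AE x in lborel. f x = 0)"
  proof
    assume "AE x in lborel. f x = 0"
    then have "AE x in lborel. x \<notin> {0<..<1::real}"
      by eventually_elim (use assms(3) in force)
    then have "emeasure lborel {0<..<1::real} = 0"
      by (subst (asm) AE_iff_measurable[where N = "{0<..<1}"]) auto
    then show False
      by simp
  qed
  then have "(LINT x|lborel. f x) \<noteq> 0"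
    using assms(1,2) by (simp add: integral_nonneg_eq_0_iff_AE)
  moreover have "0 \<le> (LINT x|lborel. f x)"
    using assms(2) by (intro Bochner_Integration.integral_nonneg)
  ultimately show ?thesis
    by simp
qed

lemma Psi_neg:
  assumes "x > 0"
  shows "Psi x < 0"
proof -
  have "0 < (LINT s|lborel. indicator {0<..} s * (exp (- s) / (x + s)))"
    using assms by (intro integral_lborel_pos integrable_exp_shift) (auto simp: indicator_def)
  then show ?thesis
    by (simp add: Psi_eq_integral)
qed

lemma Psi_strict_mono:
  assumes "0 < x" "x < y"
  shows "Psi x < Psi y"
proof -
  have "0 < (LINT s|lborel. indicator {0<..} s * (exp (- s) / (x + s))
                          - indicator {0<..} s * (exp (- s) / (y + s)))"
    using assms
    by (intro integral_lborel_pos Bochner_Integration.integrable_diff integrable_exp_shift)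
      (auto simp: indicator_def intro!: divide_left_mono divide_strict_left_mono)
  then show ?thesis
    using assms
      Bochner_Integration.integral_diff[OF integrable_exp_shift[of x] integrable_exp_shift[of y]]
    by (simp add: Psi_eq_integral)
qed

lemma Psi_mono: "0 < x \<Longrightarrow> x \<le> y \<Longrightarrow> Psi x \<le> Psi y"
  using Psi_strict_mono[of x y] by (cases "x = y") auto

section \<open>Signs of \<open>Lambda\<close> and \<open>Delta\<close>\<close>

lemma interval_lebesgue_integral_nonneg:
  fixes f :: "real \<Rightarrow> real"
  assumes "a \<le> b" "\<And>x. a < ereal x \<Longrightarrow> ereal x < b \<Longrightarrow> 0 \<le> f x"
  shows "0 \<le> (LBINT x=a..b. f x)"
  \<comment> \<open>The Bochner integral of a non-integrable function is 0, so the sign is right in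
    that case too.\<close>
  using assms unfolding interval_lebesgue_integral_def set_lebesgue_integral_def
  by (auto simp: indicator_def einterval_def intro!: Bochner_Integration.integral_nonneg)

lemma exp_sum_density_nonneg: "0 \<le> exp_sum_density \<mu> D x"
  by (simp add: exp_sum_density_def)

text \<open>Strict, because the term for \<open>D = {}\<close> alone must make \<open>coef_a\<close>
  positive.\<close>

lemma Lambda_empty_pos:
  assumes "\<gamma> (A i) Base > 0" "\<gamma> (A i) Eve > 0"
  shows "Lambda \<gamma> i {} > 0"
  using assms by (auto simp: Lambda_def intro!: Psi_strict_mono)

lemma Lambda_nonneg:
  assumes "\<gamma> (A i) Base > 0" "\<gamma> (A i) Eve > 0"
  shows "Lambda \<gamma> i D \<ge> 0"
proof (cases "D = {}")
  case True
  then show ?thesis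
    using Lambda_empty_pos[of \<gamma> i] assms by simp
next
  case False
  then show ?thesis
    using assms
    by (auto simp: Lambda_def f_dens_def g_dens_def add_pos_pos
        intro!: interval_lebesgue_integral_nonneg mult_nonneg_nonneg Psi_mono exp_sum_density_nonneg)
qed

lemma Delta_nonneg:
  assumes "0 < \<gamma> (DT j) (DR j)" "\<gamma> (DT j) (DR j) < \<gamma> (A i) (DR j)"
  shows "Delta \<gamma> i j D \<ge> 0"
  using assms
  by (auto simp: Delta_def h_dens_def frac_le
      intro!: interval_lebesgue_integral_nonneg mult_nonneg_nonneg Psi_mono exp_sum_density_nonneg)

lemma Delta_nonpos:
  assumes "0 < \<gamma> (A i) (DR j)" "\<gamma> (A i) (DR j) < \<gamma> (DT j) (DR j)"
  shows "Delta \<gamma> i j D \<le> 0"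
proof (cases "D = {}")
  case True
  then show ?thesis
    using assms by (auto simp: Delta_def frac_le intro!: Psi_mono)
next
  case False
  have "0 \<le> (LBINT x=0..\<infinity>. - (h_dens \<gamma> j D x
        * (Psi ((x + 1) / \<gamma> (DT j) (DR j)) - Psi ((x + 1) / \<gamma> (A i) (DR j)))))"
    using assms
    by (intro interval_lebesgue_integral_nonneg)
      (auto simp: h_dens_def frac_le intro!: mult_nonneg_nonpos Psi_mono exp_sum_density_nonneg)
  then show ?thesis
    using False by (simp add: Delta_def interval_lebesgue_integral_uminus)
qed

text \<open>By monotonicity of \<open>Psi\<close>, numerator and denominator change sign together:
  both are governed by which of the two SNRs at \<open>DR j\<close> is larger.\<close>

lemma Delta_ratio_nonneg:
  assumes "0 < \<gamma> (A i) (DR j)" "0 < \<gamma> (DT j) (DR j)" "\<gamma> (A i) (DR j) \<noteq> \<gamma> (DT j) (DR j)"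
  shows "0 \<le> Delta \<gamma> i j D / (real n * (\<gamma> (A i) (DR j) / \<gamma> (DT j) (DR j) - 1))"
proof (cases "\<gamma> (DT j) (DR j) < \<gamma> (A i) (DR j)")
  case True
  then show ?thesis
    using assms Delta_nonneg[of \<gamma> j i D] by (intro divide_nonneg_nonneg mult_nonneg_nonneg) auto
next
  case False
  then show ?thesis
    using assms Delta_nonpos[of \<gamma> i j D]
    by (intro divide_nonpos_nonpos mult_nonneg_nonpos) auto
qed

section \<open>Signs of the coefficients\<close>

lemma vth_le: "p \<le> 1 \<Longrightarrow> vth n p \<le> 1 - eps n p"
  and vth_less: "p < 1 \<Longrightarrow> vth n p < 1 - eps n p"
  \<comment> \<open>Both bounds rest on \<open>eps n p + vth n p = p\<close>.\<close>
  by (auto simp: vth_def eps_def algebra_simps)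

lemma eps_nonneg: "0 \<le> p \<Longrightarrow> 0 \<le> eps n p"
  by (simp add: eps_def)

lemma vth_nonneg: "0 \<le> p \<Longrightarrow> n \<ge> 1 \<Longrightarrow> 0 \<le> vth n p"
  by (simp add: vth_def)

lemma coef_a_nonneg:
  assumes "\<gamma> (A i) Base > 0" "\<gamma> (A i) Eve > 0" "n \<ge> 1" "0 \<le> p" "p \<le> 1"
  shows "0 \<le> coef_a n m \<gamma> p i"
  unfolding coef_a_def
  using assms eps_nonneg vth_nonneg vth_le Lambda_nonneg
  by (intro sum_nonneg mult_nonneg_nonneg) (auto intro!: power_mono)

text \<open>The term for \<open>D = {}\<close> has weight 1 and is positive, since
  \<open>vth n p < 1 - eps n p\<close> and the exponent m is positive. At p = 1 the two bases
  coincide and all terms vanish.\<close>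

lemma coef_a_pos:
  assumes "\<gamma> (A i) Base > 0" "\<gamma> (A i) Eve > 0" "n \<ge> 1" "0 \<le> p" "p < 1" "m \<ge> 1"
  shows "0 < coef_a n m \<gamma> p i"
  unfolding coef_a_def
proof (rule sum_pos2[where i = "{}"])
  show "0 < eps n p ^ card {} * Lambda \<gamma> i {} * ((1 - eps n p) ^ (m - card {}) - vth n p ^ (m - card {}))"
    using assms Lambda_empty_pos[of \<gamma> i] vth_less[of p n] vth_nonneg[of p n]
    by (auto intro!: mult_pos_pos power_strict_mono)
qed (use assms eps_nonneg vth_nonneg vth_le Lambda_nonneg in
      \<open>auto intro!: mult_nonneg_nonneg power_mono\<close>)

lemma coef_b_nonneg:
  assumes "\<gamma> (A i) Base > 0" "\<gamma> (A i) Eve > 0" "n \<ge> 1" "0 \<le> p"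
  shows "0 \<le> coef_b n m \<gamma> p i"
  unfolding coef_b_def
  using assms eps_nonneg vth_nonneg Lambda_nonneg
  by (intro sum_nonneg mult_nonneg_nonneg) auto

lemma coef_u_nonneg:
  assumes "\<And>i. i \<in> {1..n} \<Longrightarrow>
      0 < \<gamma> (A i) (DR j) \<and> \<gamma> (A i) (DR j) \<noteq> \<gamma> (DT j) (DR j)"
    and "0 < \<gamma> (DT j) (DR j)" "n \<ge> 1" "0 \<le> p" "p \<le> 1"
  shows "0 \<le> coef_u n m \<gamma> p j"
  unfolding coef_u_def
proof (intro sum_nonneg)
  fix i D
  assume "i \<in> {1..n}"
  \<comment> \<open>Regrouped so that \<open>Delta\<close> stands directly over the denominator that
    shares its sign.\<close>
  then have "0 \<le> eps n p ^ (card D + 1)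
      * (Delta \<gamma> i j D / (real n * (\<gamma> (A i) (DR j) / \<gamma> (DT j) (DR j) - 1)))
      * ((1 - eps n p) ^ (m - 1 - card D) - vth n p ^ (m - 1 - card D))"
    using assms eps_nonneg vth_nonneg vth_le
    by (intro mult_nonneg_nonneg Delta_ratio_nonneg) (auto intro!: power_mono)
  then show "0 \<le> eps n p ^ (card D + 1) * Delta \<gamma> i j D
      * ((1 - eps n p) ^ (m - 1 - card D) - vth n p ^ (m - 1 - card D))
      / (real n * (\<gamma> (A i) (DR j) / \<gamma> (DT j) (DR j) - 1))"
    by (simp add: mult_ac)
qed

lemma coef_v_nonneg:
  assumes "\<And>i. i \<in> {1..n} \<Longrightarrow>
      0 < \<gamma> (A i) (DR j) \<and> \<gamma> (A i) (DR j) \<noteq> \<gamma> (DT j) (DR j)"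
    and "0 < \<gamma> (DT j) (DR j)" "n \<ge> 1" "0 \<le> p"
  shows "0 \<le> coef_v n m \<gamma> p j"
  unfolding coef_v_def
proof (intro sum_nonneg)
  fix i D
  assume "i \<in> {1..n}"
  then have "0 \<le> eps n p ^ (card D + 1)
      * (Delta \<gamma> i j D / (real n * (\<gamma> (A i) (DR j) / \<gamma> (DT j) (DR j) - 1)))
      * vth n p ^ (m - 1 - card D)"
    using assms eps_nonneg vth_nonneg by (intro mult_nonneg_nonneg Delta_ratio_nonneg) auto
  then show "0 \<le> eps n p ^ (card D + 1) * Delta \<gamma> i j D * vth n p ^ (m - 1 - card D)
      / (real n * (\<gamma> (A i) (DR j) / \<gamma> (DT j) (DR j) - 1))"
    by (simp add: mult_ac)
qed

lemma coef_s_neg: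
  assumes "0 < \<gamma> (DT j) (DR j)" "0 \<le> p" "p < 1" "m \<ge> 1"
  shows "coef_s m \<gamma> p j < 0"
  unfolding coef_s_def
proof (rule mult_neg_pos)
  show "0 < (\<Sum>l=1..m. real ((m - 1) choose (l - 1)) * (p ^ (m - l) * (1 - p) ^ l / real l))"
    \<comment> \<open>The term l = m has \<open>p ^ 0 = 1\<close>, so it stays positive even at p =
      0.\<close>
    by (rule sum_pos2[where i = m]) (use assms in auto)
qed (use assms in \<open>simp add: Psi_neg\<close>)

text \<open>Each l is at least 1, so every power of 1 - p vanishes. This later rules out a negative
  slope of the D2D rate at p = 1.\<close>

lemma coef_s_1: "coef_s m \<gamma> 1 j = 0"
  by (simp add: coef_s_def)

section \<open>Maximizing weighted logarithms of affine functions\<close>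

lemma eln_mono: "x \<le> y \<Longrightarrow> eln x \<le> eln y"
  by (auto simp: eln_def)

text \<open>Concavity in tangent form; it turns the first-order condition at a point into a global
  bound.\<close>

lemma ln_tangent:
  fixes x y :: real
  assumes "0 < x" "0 < y"
  shows "ln x \<le> ln y + (x - y) / y"
  using ln_le_minus_one[of "x / y"] assms by (simp add: ln_div diff_divide_distrib)

text \<open>Here \<open>z\<close> is the zero of the derivative of the objective and
  \<open>t\<^sub>0\<close> its projection onto [0,1]. The tangents at \<open>t\<^sub>0\<close> bound
  the gain at \<open>t\<close> by a positive multiple of
  \<open>(t - t\<^sub>0) * (z - t\<^sub>0)\<close>, which is at most 0. The scalings
  \<open>k\<close> and \<open>l\<close> only add constants.\<close>

lemma weighted_eln_le_clipped:
  fixes a b u v w\<^sub>c w\<^sub>d t k l :: real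
  defines "z \<equiv> - w\<^sub>d * (b / a) - w\<^sub>c * (v / u)"
  defines "t\<^sub>0 \<equiv> min (max 0 z) 1"
  assumes "a > 0" "b \<ge> 0" "u < 0" "v > 0" and w: "w\<^sub>c > 0" "w\<^sub>d > 0" "w\<^sub>c + w\<^sub>d = 1"
    and "0 \<le> t" "t \<le> 1" "k > 0" "l > 0"
  shows "ereal w\<^sub>c * eln ((a * t + b) / k) + ereal w\<^sub>d * eln ((u * t + v) / l)
       \<le> ereal w\<^sub>c * eln ((a * t\<^sub>0 + b) / k) + ereal w\<^sub>d * eln ((u * t\<^sub>0 + v) / l)"
proof (cases "a * t + b > 0 \<and> u * t + v > 0")
  case False
  \<comment> \<open>\<open>eln\<close> never takes the value \<infinity>, so one infinite summand
    makes the whole sum -\<infinity>.\<close>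
  then have "ereal w\<^sub>c * eln ((a * t + b) / k) + ereal w\<^sub>d * eln ((u * t + v) / l) = - \<infinity>"
    using w \<open>k > 0\<close> \<open>l > 0\<close> by (auto simp: eln_def zero_less_divide_iff)
  then show ?thesis
    by (simp only: ereal_less_eq)
next
  case True
  \<comment> \<open>The tangents need positive arguments at \<open>t\<^sub>0\<close>. For
    \<open>z > 0\<close> the value at \<open>z\<close> is
    \<open>w\<^sub>d * (v - u * b / a) > 0\<close>, and moving down from \<open>z\<close> to
    \<open>t\<^sub>0\<close> only increases it because \<open>u < 0\<close>.\<close>
  have y0: "u * t\<^sub>0 + v > 0"
  proof (cases "z \<le> 0")
    case True
    then show ?thesis
      using \<open>v > 0\<close> by (simp add: t\<^sub>0_def)
  next
    case False
    have "u * z + v = - (u * w\<^sub>d * (b / a)) + w\<^sub>d * v"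
      using \<open>u < 0\<close> \<open>w\<^sub>c + w\<^sub>d = 1\<close> by (simp add: z_def algebra_simps flip: distrib_left)
    moreover have "u * w\<^sub>d * (b / a) \<le> 0"
      using assms by (intro mult_nonpos_nonneg) auto
    moreover have "w\<^sub>d * v > 0"
      using assms by simp
    moreover have "u * z \<le> u * t\<^sub>0"
      using False \<open>u < 0\<close> by (intro mult_left_mono_neg) (auto simp: t\<^sub>0_def)
    ultimately show ?thesis
      by linarith
  qed
  \<comment> \<open>Only \<open>b = 0\<close> is delicate: then
    \<open>z = - w\<^sub>c * (v / u)\<close> is positive, so clipping does not return 0.\<close>
  have x0: "a * t\<^sub>0 + b > 0"
  proof (cases "b = 0")
    case True
    then have "z > 0"
      using assms by (simp add: z_def mult_pos_neg divide_pos_neg)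
    then show ?thesis
      using True \<open>a > 0\<close> by (simp add: t\<^sub>0_def)
  next
    case False
    moreover have "t\<^sub>0 \<ge> 0"
      by (simp add: t\<^sub>0_def)
    ultimately show ?thesis
      using \<open>a > 0\<close> \<open>b \<ge> 0\<close> by (simp add: add_nonneg_pos)
  qed
  have "w\<^sub>c * ((a * t + b) - (a * t\<^sub>0 + b)) / (a * t\<^sub>0 + b)
      + w\<^sub>d * ((u * t + v) - (u * t\<^sub>0 + v)) / (u * t\<^sub>0 + v)
      = (t - t\<^sub>0) * (w\<^sub>c * a * (u * t\<^sub>0 + v) + w\<^sub>d * u * (a * t\<^sub>0 + b))
        / ((a * t\<^sub>0 + b) * (u * t\<^sub>0 + v))"
    using x0 y0 by (simp add: divide_simps) (simp add: algebra_simps)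
  \<comment> \<open>The numerator of the derivative is affine in \<open>t\<^sub>0\<close>; its slope
    is \<open>a * u\<close> because the weights sum to 1, and its zero is \<open>z\<close>.\<close>
  also have "w\<^sub>c * a * (u * t\<^sub>0 + v) + w\<^sub>d * u * (a * t\<^sub>0 + b) = (- a * u) * (z - t\<^sub>0)"
  proof -
    have wc: "w\<^sub>c = 1 - w\<^sub>d"
      using w by simp
    show ?thesis
      unfolding z_def wc using \<open>a > 0\<close> \<open>u < 0\<close> by (simp add: field_simps)
  qed
  also have "(t - t\<^sub>0) * ((- a * u) * (z - t\<^sub>0)) / ((a * t\<^sub>0 + b) * (u * t\<^sub>0 + v)) \<le> 0"
  proof (rule divide_nonpos_pos)
    \<comment> \<open>Either \<open>t\<^sub>0 = z\<close>, or \<open>t\<^sub>0\<close> is an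
      endpoint with \<open>z\<close> beyond it and \<open>t\<close> on the other side.\<close>
    have "(t - t\<^sub>0) * (z - t\<^sub>0) \<le> 0"
      using \<open>0 \<le> t\<close> \<open>t \<le> 1\<close>
      by (auto simp: t\<^sub>0_def min_def max_def mult_nonneg_nonpos mult_nonpos_nonneg)
    then have "(- a * u) * ((t - t\<^sub>0) * (z - t\<^sub>0)) \<le> 0"
      using \<open>a > 0\<close> \<open>u < 0\<close> by (intro mult_nonneg_nonpos[of "- a * u"] mult_nonpos_nonpos) auto
    then show "(t - t\<^sub>0) * ((- a * u) * (z - t\<^sub>0)) \<le> 0"
      by (simp add: mult_ac)
  qed (use x0 y0 in simp)
  finally have "w\<^sub>c * (((a * t + b) - (a * t\<^sub>0 + b)) / (a * t\<^sub>0 + b))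
      + w\<^sub>d * (((u * t + v) - (u * t\<^sub>0 + v)) / (u * t\<^sub>0 + v)) \<le> 0"
    by simp
  moreover have "w\<^sub>c * ln (a * t + b)
      \<le> w\<^sub>c * (ln (a * t\<^sub>0 + b) + ((a * t + b) - (a * t\<^sub>0 + b)) / (a * t\<^sub>0 + b))"
    using True x0 w by (intro mult_left_mono ln_tangent) auto
  moreover have "w\<^sub>d * ln (u * t + v)
      \<le> w\<^sub>d * (ln (u * t\<^sub>0 + v) + ((u * t + v) - (u * t\<^sub>0 + v)) / (u * t\<^sub>0 + v))"
    using True y0 w by (intro mult_left_mono ln_tangent) auto
  ultimately have "w\<^sub>c * ln (a * t + b) + w\<^sub>d * ln (u * t + v)
      \<le> w\<^sub>c * ln (a * t\<^sub>0 + b) + w\<^sub>d * ln (u * t\<^sub>0 + v)"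
    unfolding distrib_left by linarith
  then show ?thesis
    using True x0 y0 \<open>k > 0\<close> \<open>l > 0\<close> by (simp add: eln_def ln_div right_diff_distrib)
qed

lemma weighted_eln_mono:
  fixes w\<^sub>c w\<^sub>d :: real
  assumes "w\<^sub>c > 0" "w\<^sub>d > 0" "x \<le> x'" "y \<le> y'"
  shows "ereal w\<^sub>c * eln x + ereal w\<^sub>d * eln y \<le> ereal w\<^sub>c * eln x' + ereal w\<^sub>d * eln y'"
  using assms by (intro add_mono ereal_mult_left_mono eln_mono) auto

text \<open>Summing over users keeps both arguments affine in \<beta>, as
  \<open>weighted_eln_le_clipped\<close> requires, with \<open>k = n * ln 2\<close> and
  \<open>l = ln 2\<close>.\<close>

lemma utility_eq:
  "utility n m \<gamma> w\<^sub>c w\<^sub>d p \<beta> =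
     ereal w\<^sub>c * eln (((\<Sum>i=1..n. coef_a n m \<gamma> p i) * \<beta> + (\<Sum>i=1..n. coef_b n m \<gamma> p i))
       / (real n * ln 2))
   + ereal w\<^sub>d * eln (((\<Sum>j=1..m. coef_u n m \<gamma> p j + coef_s m \<gamma> p j) * \<beta>
       + (\<Sum>j=1..m. coef_v n m \<gamma> p j - coef_s m \<gamma> p j)) / ln 2)"
  by (simp add: utility_def Cs_def R_def sum_distrib_left sum.distrib sum_subtractf
      algebra_simps flip: sum_divide_distrib)

section \<open>Continuity in p and values at p = 0\<close>

lemma tendsto_divide_const:
  fixes c :: real
  shows "(f \<longlongrightarrow> l) F \<Longrightarrow> ((\<lambda>x. f x / c) \<longlongrightarrow> l / c) F"
  \<comment> \<open>Multiplication by \<open>inverse c\<close> is continuous for every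
    \<open>c\<close>; for \<open>c = 0\<close> both sides are 0.\<close>
  unfolding divide_inverse by (intro tendsto_intros)

text \<open>All coefficients are polynomials in p: \<open>Lambda\<close>, \<open>Delta\<close> and
  \<open>Psi\<close> enter as constants.\<close>

lemma
  fixes p\<^sub>0 :: real
  assumes "(f \<longlongrightarrow> p\<^sub>0) F"
  shows tendsto_coef_a: "((\<lambda>p. coef_a n m \<gamma> (f p) i) \<longlongrightarrow> coef_a n m \<gamma> p\<^sub>0 i) F"
    and tendsto_coef_b: "((\<lambda>p. coef_b n m \<gamma> (f p) i) \<longlongrightarrow> coef_b n m \<gamma> p\<^sub>0 i) F"
    and tendsto_coef_u: "((\<lambda>p. coef_u n m \<gamma> (f p) j) \<longlongrightarrow> coef_u n m \<gamma> p\<^sub>0 j) F"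
    and tendsto_coef_v: "((\<lambda>p. coef_v n m \<gamma> (f p) j) \<longlongrightarrow> coef_v n m \<gamma> p\<^sub>0 j) F"
    and tendsto_coef_s: "((\<lambda>p. coef_s m \<gamma> (f p) j) \<longlongrightarrow> coef_s m \<gamma> p\<^sub>0 j) F"
proof -
  have e: "((\<lambda>p. eps n (f p)) \<longlongrightarrow> eps n p\<^sub>0) F"
    unfolding eps_def by (intro tendsto_divide_const assms)
  have v: "((\<lambda>p. vth n (f p)) \<longlongrightarrow> vth n p\<^sub>0) F"
    unfolding vth_def by (intro tendsto_intros assms)
  show "((\<lambda>p. coef_a n m \<gamma> (f p) i) \<longlongrightarrow> coef_a n m \<gamma> p\<^sub>0 i) F"
    "((\<lambda>p. coef_b n m \<gamma> (f p) i) \<longlongrightarrow> coef_b n m \<gamma> p\<^sub>0 i) F"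
    unfolding coef_a_def coef_b_def by (intro tendsto_intros e v)+
  show "((\<lambda>p. coef_u n m \<gamma> (f p) j) \<longlongrightarrow> coef_u n m \<gamma> p\<^sub>0 j) F"
    "((\<lambda>p. coef_v n m \<gamma> (f p) j) \<longlongrightarrow> coef_v n m \<gamma> p\<^sub>0 j) F"
    unfolding coef_u_def coef_v_def
    by (intro tendsto_sum tendsto_divide_const tendsto_mult tendsto_diff tendsto_power
        tendsto_const e v)+
  show "((\<lambda>p. coef_s m \<gamma> (f p) j) \<longlongrightarrow> coef_s m \<gamma> p\<^sub>0 j) F"
    unfolding coef_s_def
    by (intro tendsto_sum tendsto_divide_const tendsto_mult tendsto_diff tendsto_power
        tendsto_const assms)
qed

text \<open>The exponents of \<open>eps\<close> and \<open>vth\<close> add up to m, so one of them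
  is positive, and both bases vanish at p = 0.\<close>

lemma coef_b_0: "m \<ge> 1 \<Longrightarrow> coef_b n m \<gamma> 0 i = 0"
  unfolding coef_b_def by (intro sum.neutral) (auto simp: eps_def vth_def power_0_left)

lemma coef_u_0: "coef_u n m \<gamma> 0 j = 0"
  by (simp add: coef_u_def eps_def)

lemma coef_v_0: "coef_v n m \<gamma> 0 j = 0"
  by (simp add: coef_v_def eps_def)

section \<open>Optimality for each p and the limit at 0\<close>

theorem lemma1:
  fixes n m :: nat and \<gamma> :: "node \<Rightarrow> node \<Rightarrow> real" and w\<^sub>c w\<^sub>d :: real
  assumes "n \<ge> 1" and "m \<ge> 1"
    and "\<And>x y. x \<in> nodes n m \<Longrightarrow> y \<in> nodes n m \<Longrightarrow> x \<noteq> y \<Longrightarrow> \<gamma> x y > 0"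
    and "\<And>i j. i \<in> {1..n} \<Longrightarrow> j \<in> {1..m} \<Longrightarrow> \<gamma> (A i) (DR j) \<noteq> \<gamma> (DT j) (DR j)"
    and "w\<^sub>c > 0" and "w\<^sub>d > 0" and "w\<^sub>c + w\<^sub>d = 1"
  shows "(\<forall>p\<in>{0..1}. is_arg_max (utility n m \<gamma> w\<^sub>c w\<^sub>d p) (\<lambda>\<beta>. \<beta> \<in> {0..1})
                        (beta_opt n m \<gamma> w\<^sub>c w\<^sub>d p))
       \<and> (beta_opt n m \<gamma> w\<^sub>c w\<^sub>d \<longlongrightarrow> w\<^sub>c) (at 0 within {0..1})"
proof -
  note w = \<open>w\<^sub>c > 0\<close> \<open>w\<^sub>d > 0\<close> \<open>w\<^sub>c + w\<^sub>d = 1\<close>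
  have gA: "\<gamma> (A i) Base > 0" "\<gamma> (A i) Eve > 0" if "i \<in> {1..n}" for i
    using that by (auto intro!: assms(3) simp: nodes_def)
  have gAD: "0 < \<gamma> (A i) (DR j) \<and> \<gamma> (A i) (DR j) \<noteq> \<gamma> (DT j) (DR j)"
    if "i \<in> {1..n}" "j \<in> {1..m}" for i j
    using that assms(4)[of i j] by (auto intro!: assms(3) simp: nodes_def)
  have gD: "0 < \<gamma> (DT j) (DR j)" if "j \<in> {1..m}" for j
    using that by (auto intro!: assms(3) simp: nodes_def)
  define a where "a p = (\<Sum>i=1..n. coef_a n m \<gamma> p i)" for p
  define b where "b p = (\<Sum>i=1..n. coef_b n m \<gamma> p i)" for p
  define u where "u p = (\<Sum>j=1..m. coef_u n m \<gamma> p j + coef_s m \<gamma> p j)" for p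
  define v where "v p = (\<Sum>j=1..m. coef_v n m \<gamma> p j - coef_s m \<gamma> p j)" for p
  have util: "utility n m \<gamma> w\<^sub>c w\<^sub>d p \<beta> =
      ereal w\<^sub>c * eln ((a p * \<beta> + b p) / (real n * ln 2)) + ereal w\<^sub>d * eln ((u p * \<beta> + v p) / ln 2)"
    for p \<beta>
    by (simp add: utility_eq a_def b_def u_def v_def)
  have opt: "beta_opt n m \<gamma> w\<^sub>c w\<^sub>d p =
      (if u p < 0 then min (max 0 (- w\<^sub>d * (b p / a p) - w\<^sub>c * (v p / u p))) 1 else 1)" for p
    by (simp add: beta_opt_def a_def b_def u_def v_def)
  have a_nonneg: "0 \<le> a p" if "p \<in> {0..1}" for p
    unfolding a_def using that assms(1) gA by (intro sum_nonneg coef_a_nonneg) auto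
  have a_pos: "0 < a p" if "p \<in> {0..<1}" for p
    unfolding a_def using that assms(1,2) gA by (intro sum_pos coef_a_pos) auto
  have b_nonneg: "0 \<le> b p" if "p \<in> {0..1}" for p
    unfolding b_def using that assms(1) gA by (intro sum_nonneg coef_b_nonneg) auto
  have u1: "0 \<le> u 1"
    unfolding u_def coef_s_1 using assms(1) gAD gD by (auto intro!: sum_nonneg coef_u_nonneg)
  have v_pos: "0 < v p" if "p \<in> {0..<1}" for p
    unfolding v_def
  proof (intro sum_pos)
    fix j assume j: "j \<in> {1..m}"
    have "0 \<le> coef_v n m \<gamma> p j"
      using that assms(1) gAD[OF _ j] gD[OF j] by (intro coef_v_nonneg) auto
    moreover have "coef_s m \<gamma> p j < 0"
      using that assms(2) gD[OF j] by (intro coef_s_neg) auto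
    ultimately show "0 < coef_v n m \<gamma> p j - coef_s m \<gamma> p j"
      by simp
  qed (use assms(2) in auto)
  have "utility n m \<gamma> w\<^sub>c w\<^sub>d p \<beta> \<le> utility n m \<gamma> w\<^sub>c w\<^sub>d p (beta_opt n m \<gamma> w\<^sub>c w\<^sub>d p)"
    if p: "p \<in> {0..1}" and \<beta>: "\<beta> \<in> {0..1}" for p \<beta>
  proof (cases "u p < 0")
    case True
    \<comment> \<open>Since \<open>u 1\<close> is nonnegative, this case excludes p = 1, the one
      point where \<open>a p\<close> and \<open>v p\<close> might fail to be positive.\<close>
    with u1 p have "p \<in> {0..<1}"
      by (cases "p = 1") auto
    then show ?thesis
      unfolding util opt if_P[OF True]
      using w True \<beta> p assms(1) a_pos b_nonneg v_pos
      by (intro weighted_eln_le_clipped) auto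
  next
    case False
    then show ?thesis
      unfolding util opt if_not_P[OF False]
      using w \<beta> assms(1) a_nonneg[OF p]
      by (intro weighted_eln_mono divide_right_mono add_right_mono mult_left_mono) auto
  qed
  moreover have "beta_opt n m \<gamma> w\<^sub>c w\<^sub>d p \<in> {0..1}" for p
    by (simp add: beta_opt_def)
  ultimately have "is_arg_max (utility n m \<gamma> w\<^sub>c w\<^sub>d p) (\<lambda>\<beta>. \<beta> \<in> {0..1}) (beta_opt n m \<gamma> w\<^sub>c w\<^sub>d p)"
    if "p \<in> {0..1}" for p
    using that by (auto simp: is_arg_max_linorder)
  moreover have "(beta_opt n m \<gamma> w\<^sub>c w\<^sub>d \<longlongrightarrow> w\<^sub>c) (at 0 within {0..1})"
  proof -
    let ?F = "at 0 within {0..1::real}"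
    have lim: "(a \<longlongrightarrow> a 0) ?F" "(b \<longlongrightarrow> b 0) ?F" "(u \<longlongrightarrow> u 0) ?F" "(v \<longlongrightarrow> v 0) ?F"
      unfolding a_def b_def u_def v_def
      by (intro tendsto_intros tendsto_coef_a tendsto_coef_b tendsto_coef_u tendsto_coef_v
          tendsto_coef_s)+
    have "b 0 = 0"
      using assms(2) by (simp add: b_def coef_b_0)
    \<comment> \<open>At p = 0 only the \<open>coef_s\<close> terms remain, with opposite signs. So
      v / u = -1 and, with \<open>b 0 = 0\<close>, the stationary point is \<open>w\<^sub>c\<close>,
      which lies in (0,1) and is not clipped.\<close>
    have v0: "v 0 = - u 0"
      by (simp add: u_def v_def coef_u_0 coef_v_0 sum_negf)
    with v_pos[of 0] have u0: "u 0 < 0"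
      by simp
    have "((\<lambda>p. min (max 0 (- w\<^sub>d * (b p / a p) - w\<^sub>c * (v p / u p))) 1)
        \<longlongrightarrow> min (max 0 (- w\<^sub>d * (b 0 / a 0) - w\<^sub>c * (v 0 / u 0))) 1) ?F"
      using u0 a_pos[of 0] by (intro tendsto_intros tendsto_min tendsto_max lim) auto
    also have "min (max 0 (- w\<^sub>d * (b 0 / a 0) - w\<^sub>c * (v 0 / u 0))) 1 = w\<^sub>c"
      using w u0 by (simp add: \<open>b 0 = 0\<close> v0)
    finally show ?thesis
    proof (rule Lim_transform_eventually)
      \<comment> \<open>By continuity \<open>u p\<close> stays negative near 0, so the first branch
        of \<open>beta_opt\<close> applies there.\<close>
      show "\<forall>\<^sub>F p in ?F. min (max 0 (- w\<^sub>d * (b p / a p) - w\<^sub>c * (v p / u p))) 1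
          = beta_opt n m \<gamma> w\<^sub>c w\<^sub>d p"
        using order_tendstoD(2)[OF lim(3) u0] by eventually_elim (simp add: opt)
    qed
  qed
  ultimately show ?thesis
    by blast
qed

end
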